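(* Let $a\in L^\infty_{\mathrm{loc}}([0,\infty))$ with $a(x)\ge 0$ for almost all $x>0$, let $b:(0,\infty)^2\to[0,\infty)$ be measurable with $b(x,y)=0$ for almost all $x,y$ with $x>y$, and let $\omega:[0,\infty)\to[0,\infty)$ be measurable. Assume that there exist $\kappa_1>0$, $\kappa_2\in(0,1)$ and $\eta_0>0$ such that $$\int_0^y b(x,y)\omega(x)\,\mathrm{d}x\le\kappa_1\omega(y)\quad\text{for all } y\in(0,\eta_0],\qquad \int_0^y b(x,y)\omega(x)\,\mathrm{d}x\le\kappa_2\omega(y)\quad\text{for all } y\ge\eta_0.$$ Let $(S^{(\omega)}(t))_{t\ge0}$ be the analytic, positive $C_0$-semigroup on $X_\omega$ generated by $A^{(\omega)}+B^{(\omega)}$ with domain $\mathcal{D}(A^{(\omega)})$. Then, for every $\mathring{u}\in X_\omega$, the function $u(t)=S^{(\omega)}(t)\mathring{u}$ is the unique classical solution of $$\frac{\mathrm{d}u}{\mathrm{d}t}=A^{(\omega)}u+B^{(\omega)}u,\quad t>0;\qquad u(0)=\mathring{u}.$$ If $\mathring{u}\in(X_\omega)_+$, then this solution is non-negative.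
   Context: For a non-negative measurable function $\omega$ on $[0,\infty)$, $X_\omega = L^1((0,\infty),\omega(x)\,\mathrm{d}x)$ is the real Banach space with norm $\|f\|_\omega=\int_0^\infty|f(x)|\omega(x)\,\mathrm{d}x$, ordered by the pointwise almost-everywhere order; $(X_\omega)_+$ is the set of its non-negative elements. The operators in $X_\omega$ are $A^{(\omega)}f=-af$ with domain $\mathcal{D}(A^{(\omega)})=\{f\in X_\omega: af\in X_\omega\}$, and $(B^{(\omega)}f)(x)=\int_x^\infty a(y)b(x,y)f(y)\,\mathrm{d}y$ for $x>0$, with domain $\mathcal{D}(B^{(\omega)})=\{f\in X_\omega: B^{(\omega)}f\in X_\omega\}$. Under the stated hypotheses it is known that $A^{(\omega)}+B^{(\omega)}$ with domain $\mathcal{D}(A^{(\omega)})$ generates an analytic, positive $C_0$-semigroup on $X_\omega$ (analyticity being understood on the complexification of $X_\omega$). A classical solution of $u'=Lu$ ($t>0$), $u(0)=\mathring{u}$, for a linear operator $L$ in $X_\omega$, is a function $u:[0,\infty)\to X_\omega$ that is continuous on $[0,\infty)$, continuously differentiable on $(0,\infty)$, satisfies $u(t)\in\mathcal{D}(L)$ for $t>0$, and satisfies the equation for $t>0$ and the initial condition. Here $L=A^{(\omega)}+B^{(\omega)}$. *)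

theory Defs
  imports "HOL-Analysis.Analysis"
begin

text \<open>
  Elements of an \<open>L\<^sup>1\<close> space are represented by integrable functions. Equality and order in the
  space are equality and order almost everywhere, and limits are limits in the seminorm
  \<open>L1_norm\<close>. The scalars \<open>'b\<close> are \<open>real\<close> or \<open>complex\<close>.
\<close>

definition L1 :: "'a measure \<Rightarrow> ('a \<Rightarrow> 'b :: {banach, second_countable_topology}) set"
  where "L1 M = {f. integrable M f}"

definition L1_norm :: "'a measure \<Rightarrow> ('a \<Rightarrow> 'b :: {banach, second_countable_topology}) \<Rightarrow> real"
  where "L1_norm M f = (LINT x|M. norm (f x))"

definition L1_eq :: "'a measure \<Rightarrow> ('a \<Rightarrow> 'b) \<Rightarrow> ('a \<Rightarrow> 'b) \<Rightarrow> bool"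
  where "L1_eq M f g \<longleftrightarrow> (AE x in M. f x = g x)"

definition L1_nonneg :: "'a measure \<Rightarrow> ('a \<Rightarrow> real) \<Rightarrow> bool"
  where "L1_nonneg M f \<longleftrightarrow> (AE x in M. 0 \<le> f x)"

definition L1_tendsto ::
  "'a measure \<Rightarrow> ('i \<Rightarrow> 'a \<Rightarrow> 'b :: {banach, second_countable_topology}) \<Rightarrow> ('a \<Rightarrow> 'b) \<Rightarrow> 'i filter \<Rightarrow> bool"
  where "L1_tendsto M u g F \<longleftrightarrow> ((\<lambda>s. L1_norm M (\<lambda>x. u s x - g x)) \<longlongrightarrow> 0) F"

text \<open>Bounded linear operators, linear over the scalar field \<open>'b\<close>. Compatibility with almost
  everywhere equality follows from linearity and the norm bound.\<close>

definition bounded_L1_operator ::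
  "'a measure \<Rightarrow> (('a \<Rightarrow> 'b) \<Rightarrow> ('a \<Rightarrow> 'b :: {banach, second_countable_topology, real_normed_field})) \<Rightarrow> bool"
  where "bounded_L1_operator M T \<longleftrightarrow>
    (\<forall>f\<in>L1 M. T f \<in> L1 M) \<and>
    (\<forall>f\<in>L1 M. \<forall>g\<in>L1 M. L1_eq M (T (\<lambda>x. f x + g x)) (\<lambda>x. T f x + T g x)) \<and>
    (\<forall>c. \<forall>f\<in>L1 M. L1_eq M (T (\<lambda>x. c * f x)) (\<lambda>x. c * T f x)) \<and>
    (\<exists>C. \<forall>f\<in>L1 M. L1_norm M (T f) \<le> C * L1_norm M f)"

definition C0_semigroup ::
  "'a measure \<Rightarrow> (real \<Rightarrow> ('a \<Rightarrow> real) \<Rightarrow> ('a \<Rightarrow> real)) \<Rightarrow> bool"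
  where "C0_semigroup M S \<longleftrightarrow>
    (\<forall>t\<ge>0. bounded_L1_operator M (S t)) \<and>
    (\<forall>f\<in>L1 M. L1_eq M (S 0 f) f) \<and>
    (\<forall>s\<ge>0. \<forall>t\<ge>0. \<forall>f\<in>L1 M. L1_eq M (S (s + t) f) (S s (S t f))) \<and>
    (\<forall>f\<in>L1 M. L1_tendsto M (\<lambda>t. S t f) f (at_right 0))"

definition positive_semigroup ::
  "'a measure \<Rightarrow> (real \<Rightarrow> ('a \<Rightarrow> real) \<Rightarrow> ('a \<Rightarrow> real)) \<Rightarrow> bool"
  where "positive_semigroup M S \<longleftrightarrow>
    (\<forall>t\<ge>0. \<forall>f\<in>L1 M. L1_nonneg M f \<longrightarrow> L1_nonneg M (S t f))"

definition generator_limit ::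
  "'a measure \<Rightarrow> (real \<Rightarrow> ('a \<Rightarrow> real) \<Rightarrow> ('a \<Rightarrow> real)) \<Rightarrow> ('a \<Rightarrow> real) \<Rightarrow> ('a \<Rightarrow> real) \<Rightarrow> bool"
  where "generator_limit M S f g \<longleftrightarrow>
    L1_tendsto M (\<lambda>h x. (S h f x - f x) / h) g (at_right 0)"

text \<open>The generator of \<open>S\<close> is the operator \<open>L\<close> with domain \<open>D\<close>.\<close>

definition is_generator ::
  "'a measure \<Rightarrow> (real \<Rightarrow> ('a \<Rightarrow> real) \<Rightarrow> ('a \<Rightarrow> real)) \<Rightarrow>
    ('a \<Rightarrow> real) set \<Rightarrow> (('a \<Rightarrow> real) \<Rightarrow> ('a \<Rightarrow> real)) \<Rightarrow> bool"
  where "is_generator M S D L \<longleftrightarrow>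
    D = {f \<in> L1 M. \<exists>g\<in>L1 M. generator_limit M S f g} \<and>
    (\<forall>f\<in>D. L f \<in> L1 M \<and> generator_limit M S f (L f))"

definition sector :: "real \<Rightarrow> complex set"
  where "sector \<delta> = {z. z \<noteq> 0 \<and> \<bar>Arg z\<bar> < \<delta>}"

text \<open>Analytic semigroups of angle \<open>\<delta>\<close> on a complex \<open>L\<^sup>1\<close> space. The third conjunct is complex
  differentiability of \<open>z \<mapsto> T z\<close> in the operator norm. Uniform boundedness of \<open>T\<close> on
  subsectors is not required.\<close>

definition analytic_semigroup_on_sector ::
  "'a measure \<Rightarrow> real \<Rightarrow> (complex \<Rightarrow> ('a \<Rightarrow> complex) \<Rightarrow> ('a \<Rightarrow> complex)) \<Rightarrow> bool"
  where "analytic_semigroup_on_sector M \<delta> T \<longleftrightarrow>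
    (\<forall>z\<in>insert 0 (sector \<delta>). bounded_L1_operator M (T z)) \<and>
    (\<forall>f\<in>L1 M. L1_eq M (T 0 f) f) \<and>
    (\<forall>z\<in>sector \<delta>. \<exists>T'. bounded_L1_operator M T' \<and>
      (\<forall>e>0. \<forall>\<^sub>F w in at z. \<forall>f\<in>L1 M.
        L1_norm M (\<lambda>x. (T w f x - T z f x) / (w - z) - T' f x) \<le> e * L1_norm M f)) \<and>
    (\<forall>z\<in>sector \<delta>. \<forall>w\<in>sector \<delta>. \<forall>f\<in>L1 M. L1_eq M (T (z + w) f) (T z (T w f))) \<and>
    (\<forall>\<delta>'. 0 < \<delta>' \<and> \<delta>' < \<delta> \<longrightarrow>
      (\<forall>f\<in>L1 M. L1_tendsto M (\<lambda>z. T z f) f (at 0 within sector \<delta>')))"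

definition complexify ::
  "(('a \<Rightarrow> real) \<Rightarrow> ('a \<Rightarrow> real)) \<Rightarrow> ('a \<Rightarrow> complex) \<Rightarrow> ('a \<Rightarrow> complex)"
  where "complexify T f = (\<lambda>x. Complex (T (\<lambda>y. Re (f y)) x) (T (\<lambda>y. Im (f y)) x))"

definition analytic_semigroup ::
  "'a measure \<Rightarrow> (real \<Rightarrow> ('a \<Rightarrow> real) \<Rightarrow> ('a \<Rightarrow> real)) \<Rightarrow> bool"
  where "analytic_semigroup M S \<longleftrightarrow>
    (\<exists>\<delta> T. 0 < \<delta> \<and> \<delta> \<le> pi / 2 \<and> analytic_semigroup_on_sector M \<delta> T \<and>
      (\<forall>t\<ge>0. \<forall>f\<in>L1 M. L1_eq M (T (complex_of_real t) f) (complexify (S t) f)))"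

text \<open>Only the values \<open>u t\<close> with \<open>t \<ge> 0\<close> are relevant; \<open>u'\<close> is the norm derivative of \<open>u\<close>
  on \<open>(0, \<infinity>)\<close>.\<close>

definition classical_solution ::
  "'a measure \<Rightarrow> ('a \<Rightarrow> real) set \<Rightarrow> (('a \<Rightarrow> real) \<Rightarrow> ('a \<Rightarrow> real)) \<Rightarrow>
    ('a \<Rightarrow> real) \<Rightarrow> (real \<Rightarrow> 'a \<Rightarrow> real) \<Rightarrow> bool"
  where "classical_solution M D L u0 u \<longleftrightarrow>
    (\<forall>t\<ge>0. u t \<in> L1 M) \<and>
    (\<forall>t\<ge>0. L1_tendsto M u (u t) (at t within {0..})) \<and>
    (\<exists>u'. (\<forall>t>0. u' t \<in> L1 M) \<and>
          (\<forall>t>0. L1_tendsto M (\<lambda>s x. (u s x - u t x) / (s - t)) (u' t) (at t)) \<and>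
          (\<forall>t>0. L1_tendsto M u' (u' t) (at t)) \<and>
          (\<forall>t>0. u t \<in> D \<and> L1_eq M (u' t) (L (u t)))) \<and>
    L1_eq M (u 0) u0"

definition Linf_loc :: "(real \<Rightarrow> real) set"
  where "Linf_loc = {a. a \<in> borel_measurable (lebesgue_on {0..}) \<and>
    (\<forall>K. compact K \<and> K \<subseteq> {0..} \<longrightarrow> (\<exists>C. AE x in lebesgue_on K. \<bar>a x\<bar> \<le> C))}"

text \<open>The measure \<open>\<omega>(x) dx\<close> on \<open>(0, \<infinity>)\<close>, so that \<open>X\<^sub>\<omega>\<close> is \<open>L1 (weighted \<omega>)\<close>.\<close>

definition weighted :: "(real \<Rightarrow> real) \<Rightarrow> real measure"
  where "weighted \<omega> = density (lebesgue_on {0<..}) (\<lambda>x. ennreal (\<omega> x))"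

definition A_op :: "(real \<Rightarrow> real) \<Rightarrow> (real \<Rightarrow> real) \<Rightarrow> (real \<Rightarrow> real)"
  where "A_op a f = (\<lambda>x. - (a x * f x))"

definition A_dom :: "(real \<Rightarrow> real) \<Rightarrow> (real \<Rightarrow> real) \<Rightarrow> (real \<Rightarrow> real) set"
  where "A_dom \<omega> a = {f \<in> L1 (weighted \<omega>). (\<lambda>x. a x * f x) \<in> L1 (weighted \<omega>)}"

text \<open>The Bochner integral is \<open>0\<close> by convention where the integrand is not integrable. Under the
  bounds on \<open>\<integral>\<^sub>0\<^sup>y b(x,y) \<omega>(x) dx\<close> with \<open>a\<close> and \<open>b\<close> measurable, Tonelli's theorem shows that for
  \<open>f \<in> A_dom \<omega> a\<close> the integrand is integrable for almost every \<open>x\<close> with respect to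
  \<open>weighted \<omega>\<close>, and that \<open>B_op a b f \<in> L1 (weighted \<omega>)\<close>.\<close>

definition B_op ::
  "(real \<Rightarrow> real) \<Rightarrow> (real \<Rightarrow> real \<Rightarrow> real) \<Rightarrow> (real \<Rightarrow> real) \<Rightarrow> (real \<Rightarrow> real)"
  where "B_op a b f = (\<lambda>x. LINT y|lebesgue_on {x<..}. a y * b x y * f y)"

definition AB_op ::
  "(real \<Rightarrow> real) \<Rightarrow> (real \<Rightarrow> real \<Rightarrow> real) \<Rightarrow> (real \<Rightarrow> real) \<Rightarrow> (real \<Rightarrow> real)"
  where "AB_op a b f = (\<lambda>x. A_op a f x + B_op a b f x)"

end

theory Submission
  imports Defs
begin

text \<open>
  Complex differentiability of the analytic extension in the operator norm restricts to norm
  differentiability of \<open>S\<close> on \<open>(0, \<infinity>)\<close>. The difference quotients of the orbit \<open>u t = S t f\<close> at \<open>t > 0\<close>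
  are those defining the generator at \<open>S t f\<close>, so every orbit enters the domain at once, and
  \<open>u' (s + r) = S s (u' r)\<close> makes the derivative continuous. For uniqueness, \<open>s \<mapsto> S (\<tau> - s) (v s)\<close> is
  constant for every classical solution \<open>v\<close>.
\<close>

text \<open>In \<open>S (\<tau> - s) (v s)\<close> the operator and its argument move together, so a
  product rule needs a bound on \<open>S\<close> that is uniform over nearby times. Strong
  continuity would give one through the uniform boundedness principle. Differentiability in the
  operator norm gives it directly: the error \<open>e * L1_norm M f\<close> is uniform in
  \<open>f\<close>, which yields a local Lipschitz estimate and then a local bound at every positive
  time. The second obstacle is the use of representatives: the semigroup law, linearity and the
  differential equation hold only almost everywhere. The derivative is therefore carried as a
  separate family \<open>G\<close>, and identities for it are obtained by computing one limit in two
  ways.\<close>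

section \<open>Seminorm calculus modulo null sets\<close>

lemma L1_borel_measurable: "f \<in> L1 M \<Longrightarrow> f \<in> borel_measurable M"
  by (simp add: L1_def)

lemma L1_add: "f \<in> L1 M \<Longrightarrow> g \<in> L1 M \<Longrightarrow> (\<lambda>x. f x + g x) \<in> L1 M"
  by (simp add: L1_def)

lemma L1_diff: "f \<in> L1 M \<Longrightarrow> g \<in> L1 M \<Longrightarrow> (\<lambda>x. f x - g x) \<in> L1 M"
  by (simp add: L1_def)

lemma L1_cmult:
  fixes f :: "'a \<Rightarrow> 'b :: {banach, second_countable_topology, real_normed_field}"
  shows "f \<in> L1 M \<Longrightarrow> (\<lambda>x. c * f x) \<in> L1 M"
  by (simp add: L1_def)

lemma L1_divide:
  fixes f :: "'a \<Rightarrow> 'b :: {banach, second_countable_topology, real_normed_field}"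
  shows "f \<in> L1 M \<Longrightarrow> (\<lambda>x. f x / c) \<in> L1 M"
  by (simp add: L1_def)

lemma L1_norm_nonneg: "0 \<le> L1_norm M f"
  by (simp add: L1_norm_def)

lemma L1_norm_cong:
  assumes "f \<in> L1 M" "g \<in> L1 M" "L1_eq M f g"
  shows "L1_norm M f = L1_norm M g"
  unfolding L1_norm_def
proof (rule integral_cong_AE)
  show "AE x in M. norm (f x) = norm (g x)"
    using assms(3) unfolding L1_eq_def by (rule AE_mp) simp
qed (use assms(1,2) in \<open>auto simp: L1_def\<close>)

lemma L1_norm_triangle:
  assumes "f \<in> L1 M" "g \<in> L1 M"
  shows "L1_norm M (\<lambda>x. f x + g x) \<le> L1_norm M f + L1_norm M g"
proof -
  have "L1_norm M (\<lambda>x. f x + g x) \<le> (LINT x|M. norm (f x) + norm (g x))"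
    unfolding L1_norm_def using assms
    by (intro integral_mono) (auto simp: L1_def norm_triangle_ineq)
  also have "\<dots> = L1_norm M f + L1_norm M g"
    unfolding L1_norm_def using assms by (simp add: L1_def)
  finally show ?thesis .
qed

lemma L1_norm_minus_commute: "L1_norm M (\<lambda>x. f x - g x) = L1_norm M (\<lambda>x. g x - f x)"
  by (simp add: L1_norm_def norm_minus_commute)

lemma L1_norm_cmult:
  fixes f :: "'a \<Rightarrow> 'b :: {banach, second_countable_topology, real_normed_field}"
  shows "L1_norm M (\<lambda>x. c * f x) = norm c * L1_norm M f"
  by (simp add: L1_norm_def norm_mult)

lemma L1_eq_iff_norm:
  assumes "f \<in> L1 M" "g \<in> L1 M"
  shows "L1_eq M f g \<longleftrightarrow> L1_norm M (\<lambda>x. f x - g x) = 0"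
proof -
  have "integrable M (\<lambda>x. norm (f x - g x))"
    using assms by (simp add: L1_def)
  then show ?thesis
    unfolding L1_eq_def L1_norm_def by (simp add: integral_nonneg_eq_0_iff_AE)
qed

lemma L1_eq_sym: "L1_eq M f g \<Longrightarrow> L1_eq M g f"
  unfolding L1_eq_def by (simp add: eq_commute)

lemma L1_eq_trans:
  assumes "L1_eq M f g" "L1_eq M g h"
  shows "L1_eq M f h"
  using assms unfolding L1_eq_def by eventually_elim simp

lemma L1_eq_diff:
  assumes "L1_eq M f f'" "L1_eq M g g'"
  shows "L1_eq M (\<lambda>x. f x - g x) (\<lambda>x. f' x - g' x)"
  using assms unfolding L1_eq_def by eventually_elim simp

lemma L1_eq_divide:
  fixes f g :: "'a \<Rightarrow> 'b :: field"
  assumes "L1_eq M f g"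
  shows "L1_eq M (\<lambda>x. f x / c) (\<lambda>x. g x / c)"
  using assms unfolding L1_eq_def by eventually_elim simp

lemma L1_eq_refl: "L1_eq M f f"
  by (simp add: L1_eq_def)

text \<open>Difference quotients rewritten by the semigroup law or by linearity change on null sets;
  this moves limits across such rewriting. Membership in \<open>L1 M\<close> is asked of both
  families because equality almost everywhere does not transport measurability for an incomplete
  measure.\<close>

lemma L1_tendsto_cong:
  assumes "L1_tendsto M u g F"
    and "\<forall>\<^sub>F s in F. u s \<in> L1 M \<and> v s \<in> L1 M \<and> L1_eq M (u s) (v s)"
    and "g \<in> L1 M" "h \<in> L1 M" "L1_eq M g h"
  shows "L1_tendsto M v h F"
proof -
  have "\<forall>\<^sub>F s in F. L1_norm M (\<lambda>x. u s x - g x) = L1_norm M (\<lambda>x. v s x - h x)"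
    using assms(2)
    by (rule eventually_mono) (intro L1_norm_cong L1_diff L1_eq_diff; use assms in simp)
  then show ?thesis
    using assms(1) unfolding L1_tendsto_def by (simp add: tendsto_cong)
qed

lemma L1_tendsto_unique:
  assumes "L1_tendsto M u g F" "L1_tendsto M u h F" "F \<noteq> bot"
    and "\<forall>\<^sub>F s in F. u s \<in> L1 M" "g \<in> L1 M" "h \<in> L1 M"
  shows "L1_eq M g h"
proof -
  have "\<forall>\<^sub>F s in F. L1_norm M (\<lambda>x. g x - h x)
      \<le> L1_norm M (\<lambda>x. u s x - g x) + L1_norm M (\<lambda>x. u s x - h x)"
    using assms(4)
  proof (rule eventually_mono)
    fix s assume "u s \<in> L1 M"
    then show "L1_norm M (\<lambda>x. g x - h x)
        \<le> L1_norm M (\<lambda>x. u s x - g x) + L1_norm M (\<lambda>x. u s x - h x)"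
      using L1_norm_triangle[of "\<lambda>x. g x - u s x" M "\<lambda>x. u s x - h x"] assms
      by (simp add: L1_diff L1_norm_minus_commute[of M g])
  qed
  moreover have "((\<lambda>s. L1_norm M (\<lambda>x. u s x - g x) + L1_norm M (\<lambda>x. u s x - h x)) \<longlongrightarrow> 0 + 0) F"
    using assms(1,2) unfolding L1_tendsto_def by (rule tendsto_add)
  ultimately have "L1_norm M (\<lambda>x. g x - h x) \<le> 0"
    using tendsto_lowerbound[OF _ _ assms(3)] by fastforce
  then show ?thesis
    using assms(5,6) L1_norm_nonneg[of M "\<lambda>x. g x - h x"] by (simp add: L1_eq_iff_norm)
qed

lemma L1_tendsto_compose:
  assumes "L1_tendsto M u g F" "filterlim p F G"
  shows "L1_tendsto M (\<lambda>s. u (p s)) g G"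
  using assms(1) filterlim_compose[OF _ assms(2)] unfolding L1_tendsto_def by fastforce

section \<open>Bounded operators on representatives\<close>

lemma bounded_L1_operatorD:
  fixes f g :: "'a \<Rightarrow> 'b :: {banach, second_countable_topology, real_normed_field}"
  assumes "bounded_L1_operator M T"
  shows "f \<in> L1 M \<Longrightarrow> T f \<in> L1 M"
    and "f \<in> L1 M \<Longrightarrow> g \<in> L1 M \<Longrightarrow> L1_eq M (T (\<lambda>x. f x + g x)) (\<lambda>x. T f x + T g x)"
    and "f \<in> L1 M \<Longrightarrow> L1_eq M (T (\<lambda>x. c * f x)) (\<lambda>x. c * T f x)"
  using assms unfolding bounded_L1_operator_def by blast+

lemma bounded_L1_operator_bound:
  fixes T :: "('a \<Rightarrow> 'b) \<Rightarrow> ('a \<Rightarrow> 'b :: {banach, second_countable_topology, real_normed_field})"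
  assumes "bounded_L1_operator M T"
  obtains C where "0 \<le> C" "\<And>f :: 'a \<Rightarrow> 'b. f \<in> L1 M \<Longrightarrow> L1_norm M (T f) \<le> C * L1_norm M f"
proof -
  obtain C where C: "\<And>f. f \<in> L1 M \<Longrightarrow> L1_norm M (T f) \<le> C * L1_norm M f"
    using assms unfolding bounded_L1_operator_def by blast
  show ?thesis
  proof (rule that[of "max C 0"])
    fix f :: "'a \<Rightarrow> 'b" assume "f \<in> L1 M"
    then show "L1_norm M (T f) \<le> max C 0 * L1_norm M f"
      using C mult_right_mono[OF max.cobounded1 L1_norm_nonneg] by (meson order_trans)
  qed simp
qed

lemma bounded_L1_operator_diff:
  assumes "bounded_L1_operator M T" "f \<in> L1 M" "g \<in> L1 M"
  shows "L1_eq M (T (\<lambda>x. f x - g x)) (\<lambda>x. T f x - T g x)"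
proof -
  have "L1_eq M (T (\<lambda>x. f x + - 1 * g x)) (\<lambda>x. T f x + T (\<lambda>x. - 1 * g x) x)"
    by (intro bounded_L1_operatorD(2)[OF assms(1)] L1_cmult assms)
  moreover have "L1_eq M (T (\<lambda>x. - 1 * g x)) (\<lambda>x. - 1 * T g x)"
    by (intro bounded_L1_operatorD(3)[OF assms(1)] assms)
  ultimately show ?thesis
    unfolding L1_eq_def by eventually_elim simp
qed

lemma bounded_L1_operator_quotient:
  assumes "bounded_L1_operator M T" "f \<in> L1 M" "g \<in> L1 M"
  shows "L1_eq M (T (\<lambda>x. (f x - g x) / c)) (\<lambda>x. (T f x - T g x) / c)"
proof -
  \<comment> \<open>Homogeneity is available for products only, so division by \<open>c\<close> is
    read as multiplication by \<open>inverse c\<close>; with the convention for division by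
    \<open>0\<close> this covers \<open>c = 0\<close> as well.\<close>
  have "L1_eq M (T (\<lambda>x. inverse c * (f x - g x))) (\<lambda>x. inverse c * T (\<lambda>x. f x - g x) x)"
    by (intro bounded_L1_operatorD(3)[OF assms(1)] L1_diff assms)
  then show ?thesis
    using bounded_L1_operator_diff[OF assms]
    unfolding L1_eq_def by eventually_elim (simp add: field_simps)
qed

lemma bounded_L1_operator_cong:
  assumes "bounded_L1_operator M T" "f \<in> L1 M" "g \<in> L1 M" "L1_eq M f g"
  shows "L1_eq M (T f) (T g)"
proof -
  note T = bounded_L1_operatorD(1)[OF assms(1)]
  obtain C where C: "\<And>f. f \<in> L1 M \<Longrightarrow> L1_norm M (T f) \<le> C * L1_norm M f"
    using bounded_L1_operator_bound[OF assms(1)] by blast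
  have "L1_norm M (\<lambda>x. T f x - T g x) = L1_norm M (T (\<lambda>x. f x - g x))"
    by (rule L1_norm_cong; intro L1_diff T assms L1_eq_sym[OF bounded_L1_operator_diff])
  also have "\<dots> \<le> C * L1_norm M (\<lambda>x. f x - g x)"
    by (intro C L1_diff assms)
  also have "\<dots> = 0"
    using assms by (simp add: L1_eq_iff_norm)
  finally show ?thesis
    using assms T L1_norm_nonneg[of M "\<lambda>x. T f x - T g x"] by (simp add: L1_eq_iff_norm)
qed

lemma bounded_L1_operator_tendsto:
  assumes "bounded_L1_operator M T" "L1_tendsto M u g F" "\<forall>\<^sub>F s in F. u s \<in> L1 M" "g \<in> L1 M"
  shows "L1_tendsto M (\<lambda>s. T (u s)) (T g) F"
proof -
  obtain C where C: "\<And>f. f \<in> L1 M \<Longrightarrow> L1_norm M (T f) \<le> C * L1_norm M f"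
    using bounded_L1_operator_bound[OF assms(1)] by blast
  have "\<forall>\<^sub>F s in F. L1_norm M (\<lambda>x. T (u s) x - T g x) \<le> C * L1_norm M (\<lambda>x. u s x - g x)"
    using assms(3)
  proof (rule eventually_mono)
    fix s assume s: "u s \<in> L1 M"
    have "L1_norm M (\<lambda>x. T (u s) x - T g x) = L1_norm M (T (\<lambda>x. u s x - g x))"
      by (rule L1_norm_cong; intro L1_diff bounded_L1_operatorD(1)[OF assms(1)] assms s
          L1_eq_sym[OF bounded_L1_operator_diff])
    also have "\<dots> \<le> C * L1_norm M (\<lambda>x. u s x - g x)"
      by (intro C L1_diff assms s)
    finally show "L1_norm M (\<lambda>x. T (u s) x - T g x) \<le> C * L1_norm M (\<lambda>x. u s x - g x)" .
  qed
  then have "\<forall>\<^sub>F s in F. norm (L1_norm M (\<lambda>x. T (u s) x - T g x)) \<le> C * L1_norm M (\<lambda>x. u s x - g x)"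
    by (simp add: L1_norm_nonneg)
  moreover have "((\<lambda>s. C * L1_norm M (\<lambda>x. u s x - g x)) \<longlongrightarrow> 0) F"
    using assms(2) unfolding L1_tendsto_def by (rule tendsto_mult_right_zero)
  ultimately show ?thesis
    unfolding L1_tendsto_def by (rule Lim_null_comparison)
qed

text \<open>A curve is tested against the sign of the difference of its end values; this reduces the
  claim to the mean value theorem for real functions.\<close>

lemma L1_zero_derivative_imp_const:
  fixes w :: "real \<Rightarrow> 'a \<Rightarrow> real"
  assumes "p < q" and w: "\<And>s. s \<in> {p..q} \<Longrightarrow> w s \<in> L1 M"
    and cont: "\<And>s. s \<in> {p..q} \<Longrightarrow> L1_tendsto M w (w s) (at s within {p..q})"
    and deriv: "\<And>s. s \<in> {p<..<q} \<Longrightarrow>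
      L1_tendsto M (\<lambda>r x. (w r x - w s x) / (r - s)) (\<lambda>x. 0) (at s)"
  shows "L1_eq M (w p) (w q)"
proof -
  \<comment> \<open>An explicit norming functional: \<open>\<phi>\<close> takes values in
    \<open>{-1, 0, 1}\<close>, so \<open>\<Phi>\<close> is bounded by \<open>L1_norm\<close>, and
    \<open>sgn d * d = \<bar>d\<bar>\<close> makes \<open>\<Phi>\<close> attain the norm at
    \<open>w q - w p\<close>.\<close>
  define \<phi> where "\<phi> = (\<lambda>x. sgn (w q x - w p x))"
  define \<Phi> where "\<Phi> f = (LINT x|M. \<phi> x * f x)" for f
  have wm: "w p \<in> L1 M" "w q \<in> L1 M"
    using w \<open>p < q\<close> by auto
  have \<phi>_meas: "\<phi> \<in> borel_measurable M"
    unfolding \<phi>_def using wm[THEN L1_borel_measurable] by measurable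
  have int: "integrable M (\<lambda>x. \<phi> x * f x)" if "f \<in> L1 M" for f
  proof (rule Bochner_Integration.integrable_bound)
    show "integrable M f" using that by (simp add: L1_def)
    show "(\<lambda>x. \<phi> x * f x) \<in> borel_measurable M"
      using \<phi>_meas L1_borel_measurable[OF that] by measurable
    show "AE x in M. norm (\<phi> x * f x) \<le> norm (f x)"
      by (auto simp: \<phi>_def sgn_if)
  qed
  have \<Phi>_diff: "\<Phi> f - \<Phi> g = \<Phi> (\<lambda>x. f x - g x)" if "f \<in> L1 M" "g \<in> L1 M" for f g
    unfolding \<Phi>_def using int[OF that(1)] int[OF that(2)] by (simp add: right_diff_distrib)
  have \<Phi>_bound: "\<bar>\<Phi> f\<bar> \<le> L1_norm M f" if "f \<in> L1 M" for f
  proof -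
    have "\<bar>\<Phi> f\<bar> \<le> (LINT x|M. \<bar>\<phi> x * f x\<bar>)"
      unfolding \<Phi>_def by (rule integral_abs_bound)
    also have "\<dots> \<le> L1_norm M f"
      unfolding L1_norm_def using int[OF that] that
      by (intro integral_mono) (auto simp: L1_def \<phi>_def sgn_if)
    finally show ?thesis .
  qed
  have "\<Phi> (w q) = \<Phi> (w p)"
  proof (rule DERIV_isconst_end[OF \<open>p < q\<close>])
    show "continuous_on {p..q} (\<lambda>s. \<Phi> (w s))"
      unfolding continuous_on_def
    proof
      fix s assume s: "s \<in> {p..q}"
      have "\<forall>\<^sub>F r in at s within {p..q}. norm (\<Phi> (w r) - \<Phi> (w s)) \<le> L1_norm M (\<lambda>x. w r x - w s x)"
        unfolding eventually_at_filter
        by (intro always_eventually allI impI)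
          (simp only: \<Phi>_diff w s real_norm_def \<Phi>_bound L1_diff)
      then show "((\<lambda>s. \<Phi> (w s)) \<longlongrightarrow> \<Phi> (w s)) (at s within {p..q})"
        using cont[OF s] unfolding L1_tendsto_def
        by (subst Lim_null) (rule Lim_null_comparison)
    qed
    fix s assume s: "p < s" "s < q"
    have "\<forall>\<^sub>F r in at s. norm ((\<Phi> (w r) - \<Phi> (w s)) / (r - s))
        \<le> L1_norm M (\<lambda>x. (w r x - w s x) / (r - s) - 0)"
    proof -
      have "\<forall>\<^sub>F r in at s. r \<in> {p<..<q}"
        using s by (intro eventually_at_in_open') auto
      then show ?thesis
      proof (rule eventually_mono)
        fix r assume "r \<in> {p<..<q}"
        then have r: "w r \<in> L1 M" "w s \<in> L1 M" using w s by auto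
        have "(\<Phi> (w r) - \<Phi> (w s)) / (r - s) = \<Phi> (\<lambda>x. (w r x - w s x) / (r - s))"
          unfolding \<Phi>_diff[OF r] by (simp add: \<Phi>_def)
        then show "norm ((\<Phi> (w r) - \<Phi> (w s)) / (r - s))
            \<le> L1_norm M (\<lambda>x. (w r x - w s x) / (r - s) - 0)"
          using \<Phi>_bound[OF L1_divide[OF L1_diff[OF r]]] by simp
      qed
    qed
    moreover have "((\<lambda>r. L1_norm M (\<lambda>x. (w r x - w s x) / (r - s) - 0)) \<longlongrightarrow> 0) (at s)"
      using deriv[of s] s by (simp add: L1_tendsto_def)
    ultimately show "((\<lambda>s. \<Phi> (w s)) has_field_derivative 0) (at s)"
      unfolding has_field_derivative_iff by (rule Lim_null_comparison)
  qed
  moreover have "\<Phi> (w q) - \<Phi> (w p) = L1_norm M (\<lambda>x. w q x - w p x)"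
    unfolding \<Phi>_diff[OF wm(2,1)]
    by (simp add: \<Phi>_def L1_norm_def \<phi>_def abs_sgn mult.commute)
  ultimately show ?thesis
    using wm by (simp add: L1_eq_iff_norm L1_norm_minus_commute[of M "w p"])
qed

section \<open>From the complex sector to the positive half-line\<close>

lemma eventually_pos: "0 < t \<Longrightarrow> \<forall>\<^sub>F s :: real in at t. 0 < s"
  using eventually_at_in_open'[of "{0<..}" t] by simp

lemma eventually_at_right_0: "\<forall>\<^sub>F h :: real in at_right 0. 0 < h"
  by (simp add: eventually_at_filter)

lemma of_real_in_sector: "0 < \<delta> \<Longrightarrow> 0 < t \<Longrightarrow> complex_of_real t \<in> sector \<delta>"
  by (simp add: sector_def)

text \<open>The operator is \<open>f \<mapsto> Re (T' f)\<close> on real \<open>f\<close>, with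
  \<open>T'\<close> the complex derivative of the extension at \<open>t\<close>. Embedding real
  functions is isometric and taking real parts is contractive, so both the bound and the error
  estimate survive, still uniformly in \<open>f\<close>.\<close>

lemma analytic_semigroup_derivative:
  fixes S :: "real \<Rightarrow> ('a \<Rightarrow> real) \<Rightarrow> ('a \<Rightarrow> real)"
  assumes "analytic_semigroup M S"
    and S: "\<And>t. 0 \<le> t \<Longrightarrow> bounded_L1_operator M (S t)"
    and "0 < t"
  obtains G C where "\<And>f. f \<in> L1 M \<Longrightarrow> G f \<in> L1 M"
    and "\<And>f. f \<in> L1 M \<Longrightarrow> L1_norm M (G f) \<le> C * L1_norm M f"
    and "\<And>e. 0 < e \<Longrightarrow> \<forall>\<^sub>F s in at t. \<forall>f\<in>L1 M.
      L1_norm M (\<lambda>x. (S s f x - S t f x) / (s - t) - G f x) \<le> e * L1_norm M f"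
proof -
  obtain \<delta> T where "0 < \<delta>" and T: "analytic_semigroup_on_sector M \<delta> T"
    and TS: "\<And>t f. 0 \<le> t \<Longrightarrow> f \<in> L1 M \<Longrightarrow> L1_eq M (T (complex_of_real t) f) (complexify (S t) f)"
    using assms(1) unfolding analytic_semigroup_def by blast
  have sec: "complex_of_real s \<in> sector \<delta>" if "0 < s" for s
    using of_real_in_sector[OF \<open>0 < \<delta>\<close> that] .
  have T_op: "bounded_L1_operator M (T z)" if "z \<in> sector \<delta>" for z
    using T that unfolding analytic_semigroup_on_sector_def by blast
  obtain T' where T': "bounded_L1_operator M T'"
    and T'_lim: "\<And>e. 0 < e \<Longrightarrow> \<forall>\<^sub>F w in at (complex_of_real t). \<forall>f\<in>L1 M.
        L1_norm M (\<lambda>x. (T w f x - T (complex_of_real t) f x) / (w - complex_of_real t) - T' f x)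
          \<le> e * L1_norm M f"
    using T sec[OF \<open>0 < t\<close>] unfolding analytic_semigroup_on_sector_def by meson
  obtain C where C: "\<And>f. f \<in> L1 M \<Longrightarrow> L1_norm M (T' f) \<le> C * L1_norm M f"
    using bounded_L1_operator_bound[OF T'] by blast
  define \<iota> :: "('a \<Rightarrow> real) \<Rightarrow> 'a \<Rightarrow> complex" where "\<iota> f = (\<lambda>x. complex_of_real (f x))" for f
  have \<iota>: "\<iota> f \<in> L1 M" "L1_norm M (\<iota> f) = L1_norm M f" if "f \<in> L1 M" for f
    using that by (simp_all add: L1_def \<iota>_def L1_norm_def)
  have Re_L1: "(\<lambda>x. Re (f x)) \<in> L1 M" "L1_norm M (\<lambda>x. Re (f x)) \<le> L1_norm M f"
    if "f \<in> L1 M" for f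
  proof -
    show Re: "(\<lambda>x. Re (f x)) \<in> L1 M"
      using that by (simp add: L1_def)
    show "L1_norm M (\<lambda>x. Re (f x)) \<le> L1_norm M f"
      using that Re unfolding L1_norm_def
      by (intro integral_mono) (auto simp: L1_def abs_Re_le_cmod)
  qed
  \<comment> \<open>The real part of \<open>complexify (S s) (\<iota> f)\<close> is
    \<open>S s\<close> applied to the real part of \<open>\<iota> f\<close>, which is
    \<open>f\<close> itself, so no change of representative occurs inside
    \<open>S s\<close>.\<close>
  have Re_T: "AE x in M. Re (T (complex_of_real s) (\<iota> f) x) = S s f x" if "0 < s" "f \<in> L1 M" for s f
    using TS[of s "\<iota> f"] that \<iota> unfolding L1_eq_def
    by (auto simp: complexify_def \<iota>_def)
  show ?thesis
  proof (rule that[of "\<lambda>f x. Re (T' (\<iota> f) x)" C])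
    fix f :: "'a \<Rightarrow> real" assume "f \<in> L1 M"
    then have "T' (\<iota> f) \<in> L1 M"
      using \<iota> bounded_L1_operatorD(1)[OF T'] by blast
    then show "(\<lambda>x. Re (T' (\<iota> f) x)) \<in> L1 M"
      and "L1_norm M (\<lambda>x. Re (T' (\<iota> f) x)) \<le> C * L1_norm M f"
      using Re_L1 C[of "\<iota> f"] \<iota> \<open>f \<in> L1 M\<close> by (auto intro: order_trans)
  next
    fix e :: real assume "0 < e"
    have "filterlim complex_of_real (at (complex_of_real t)) (at t)"
      by (intro filterlim_atI tendsto_of_real tendsto_ident_at)
        (auto simp: eventually_at_filter)
    from eventually_compose_filterlim[OF T'_lim[OF \<open>0 < e\<close>] this]
      eventually_pos[OF \<open>0 < t\<close>]
    show "\<forall>\<^sub>F s in at t. \<forall>f\<in>L1 M.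
        L1_norm M (\<lambda>x. (S s f x - S t f x) / (s - t) - Re (T' (\<iota> f) x)) \<le> e * L1_norm M f"
    proof (eventually_elim, intro ballI)
      fix s and f :: "'a \<Rightarrow> real"
      assume s: "\<forall>f\<in>L1 M. L1_norm M (\<lambda>x. (T (complex_of_real s) f x - T (complex_of_real t) f x) /
          (complex_of_real s - complex_of_real t) - T' f x) \<le> e * L1_norm M f"
        and "0 < s" and f: "f \<in> L1 M"
      let ?q = "\<lambda>x. (T (complex_of_real s) (\<iota> f) x - T (complex_of_real t) (\<iota> f) x) /
          (complex_of_real s - complex_of_real t) - T' (\<iota> f) x"
      have q: "?q \<in> L1 M"
        by (intro L1_diff L1_divide bounded_L1_operatorD(1)[OF T_op]
            bounded_L1_operatorD(1)[OF T'] sec \<iota> f \<open>0 < s\<close> \<open>0 < t\<close>)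
      \<comment> \<open>The denominator is the real number \<open>s - t\<close>, so taking real
        parts commutes with the division.\<close>
      have eq: "L1_eq M (\<lambda>x. Re (?q x)) (\<lambda>x. (S s f x - S t f x) / (s - t) - Re (T' (\<iota> f) x))"
        using Re_T[OF \<open>0 < s\<close> f] Re_T[OF \<open>0 < t\<close> f] unfolding L1_eq_def
      proof eventually_elim
        case (elim x)
        then show ?case
          by (simp flip: of_real_diff)
      qed
      have "L1_norm M (\<lambda>x. (S s f x - S t f x) / (s - t) - Re (T' (\<iota> f) x))
          = L1_norm M (\<lambda>x. Re (?q x))"
      proof (rule L1_norm_cong[OF _ _ L1_eq_sym[OF eq]])
        show "(\<lambda>x. (S s f x - S t f x) / (s - t) - Re (T' (\<iota> f) x)) \<in> L1 M"
          using \<open>0 < s\<close> \<open>0 < t\<close>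
          by (intro L1_diff L1_divide bounded_L1_operatorD(1)[OF S] Re_L1
              bounded_L1_operatorD(1)[OF T'] \<iota> f) auto
      qed (rule Re_L1[OF q])
      also have "\<dots> \<le> L1_norm M ?q"
        by (rule Re_L1[OF q])
      also have "\<dots> \<le> e * L1_norm M f"
        using s \<iota>[OF f] by fastforce
      finally show "L1_norm M (\<lambda>x. (S s f x - S t f x) / (s - t) - Re (T' (\<iota> f) x))
          \<le> e * L1_norm M f" .
    qed
  qed
qed

text \<open>Everything retained from analyticity, in purely real terms. \<open>G t\<close> is the
  operator-norm derivative of \<open>S\<close> at \<open>t > 0\<close>, to be identified later with
  the generator composed with \<open>S t\<close>.\<close>

locale differentiable_C0_semigroup =
  fixes M :: "'a measure" and S :: "real \<Rightarrow> ('a \<Rightarrow> real) \<Rightarrow> ('a \<Rightarrow> real)"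
    and G :: "real \<Rightarrow> ('a \<Rightarrow> real) \<Rightarrow> ('a \<Rightarrow> real)"
  assumes semigroup: "C0_semigroup M S"
    and G_L1: "0 < t \<Longrightarrow> f \<in> L1 M \<Longrightarrow> G t f \<in> L1 M"
    and G_bound: "0 < t \<Longrightarrow> \<exists>C. \<forall>f\<in>L1 M. L1_norm M (G t f) \<le> C * L1_norm M f"
    and G_lim: "0 < t \<Longrightarrow> 0 < e \<Longrightarrow> \<forall>\<^sub>F s in at t. \<forall>f\<in>L1 M.
      L1_norm M (\<lambda>x. (S s f x - S t f x) / (s - t) - G t f x) \<le> e * L1_norm M f"

text \<open>The derivative at each time comes from an existence statement and is determined only up
  to null sets, so the family \<open>G\<close> is selected by the axiom of choice.\<close>

lemma analytic_semigroup_differentiable: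
  assumes "C0_semigroup M S" "analytic_semigroup M S"
  obtains G where "differentiable_C0_semigroup M S G"
proof -
  define P where "P t G \<longleftrightarrow> (\<forall>f\<in>L1 M. G f \<in> L1 M) \<and> (\<exists>C. \<forall>f\<in>L1 M. L1_norm M (G f) \<le> C * L1_norm M f) \<and>
      (\<forall>e>0. \<forall>\<^sub>F s in at t. \<forall>f\<in>L1 M.
        L1_norm M (\<lambda>x. (S s f x - S t f x) / (s - t) - G f x) \<le> e * L1_norm M f)" for t G
  have op: "bounded_L1_operator M (S t)" if "0 \<le> t" for t
    using assms(1) that by (simp add: C0_semigroup_def)
  have "\<exists>G. P t G" if "0 < t" for t
  proof (rule analytic_semigroup_derivative[OF assms(2) op that])
    fix G C
    assume "\<And>f. f \<in> L1 M \<Longrightarrow> G f \<in> L1 M"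
      and "\<And>f. f \<in> L1 M \<Longrightarrow> L1_norm M (G f) \<le> C * L1_norm M f"
      and "\<And>e. 0 < e \<Longrightarrow> \<forall>\<^sub>F s in at t. \<forall>f\<in>L1 M.
        L1_norm M (\<lambda>x. (S s f x - S t f x) / (s - t) - G f x) \<le> e * L1_norm M f"
    then have "P t G"
      unfolding P_def by (intro conjI exI[of _ C] ballI allI impI)
    then show ?thesis by (rule exI[of "P t"])
  qed assumption
  then have "\<forall>t. \<exists>G. 0 < t \<longrightarrow> P t G"
    by blast
  from choice[OF this] obtain G where "\<forall>t. 0 < t \<longrightarrow> P t (G t)" ..
  then have G: "P t (G t)" if "0 < t" for t
    using that by blast
  have "differentiable_C0_semigroup M S G"
  proof
    fix t :: real assume "0 < t"
    note G[OF this, unfolded P_def]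
    then show "\<And>f. f \<in> L1 M \<Longrightarrow> G t f \<in> L1 M"
      and "\<exists>C. \<forall>f\<in>L1 M. L1_norm M (G t f) \<le> C * L1_norm M f"
      and "\<And>e. 0 < e \<Longrightarrow> \<forall>\<^sub>F s in at t. \<forall>f\<in>L1 M.
        L1_norm M (\<lambda>x. (S s f x - S t f x) / (s - t) - G t f x) \<le> e * L1_norm M f"
      by simp_all
  qed (rule assms(1))
  then show ?thesis by (rule that)
qed

section \<open>Regularity of orbits and their relation to the generator\<close>

context differentiable_C0_semigroup
begin

lemma S_op: "0 \<le> t \<Longrightarrow> bounded_L1_operator M (S t)"
  using semigroup by (simp add: C0_semigroup_def)

lemma S_L1: "0 \<le> t \<Longrightarrow> f \<in> L1 M \<Longrightarrow> S t f \<in> L1 M"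
  using bounded_L1_operatorD(1)[OF S_op] .

lemma S_zero: "f \<in> L1 M \<Longrightarrow> L1_eq M (S 0 f) f"
  using semigroup by (simp add: C0_semigroup_def)

lemma S_add: "0 \<le> s \<Longrightarrow> 0 \<le> t \<Longrightarrow> f \<in> L1 M \<Longrightarrow> L1_eq M (S (s + t) f) (S s (S t f))"
  using semigroup by (simp add: C0_semigroup_def)

lemma S_tendsto_0: "f \<in> L1 M \<Longrightarrow> L1_tendsto M (\<lambda>t. S t f) f (at_right 0)"
  using semigroup by (simp add: C0_semigroup_def)

lemma S_derivative:
  assumes "0 < t" "f \<in> L1 M"
  shows "L1_tendsto M (\<lambda>s x. (S s f x - S t f x) / (s - t)) (G t f) (at t)"
  unfolding L1_tendsto_def
proof (rule tendstoI)
  fix e :: real assume "0 < e"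
  \<comment> \<open>The summand \<open>1\<close> avoids a division by zero when \<open>f\<close>
    vanishes almost everywhere and makes \<open>d * L1_norm M f < e\<close> strict.\<close>
  define d where "d = e / (L1_norm M f + 1)"
  have pos: "0 < L1_norm M f + 1"
    using L1_norm_nonneg[of M f] by linarith
  have "0 < d" using \<open>0 < e\<close> pos by (simp add: d_def)
  have "d * L1_norm M f < e"
    using pos \<open>0 < e\<close> by (simp add: d_def field_simps)
  then show "\<forall>\<^sub>F s in at t.
      dist (L1_norm M (\<lambda>x. (S s f x - S t f x) / (s - t) - G t f x)) 0 < e"
    using G_lim[OF \<open>0 < t\<close> \<open>0 < d\<close>]
    by (elim eventually_mono) (use assms in \<open>fastforce simp: L1_norm_nonneg\<close>)
qed

text \<open>Taking error \<open>1\<close> in the operator-norm limit bounds the difference quotient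
  by \<open>L1_norm M f\<close> plus the norm of \<open>G t f\<close>, for all \<open>f\<close> on
  one common neighbourhood of \<open>t\<close>.\<close>

lemma S_locally_Lipschitz:
  assumes "0 < t"
  obtains K where "0 \<le> K"
    and "\<forall>\<^sub>F s in at t. \<forall>f\<in>L1 M. L1_norm M (\<lambda>x. S s f x - S t f x) \<le> \<bar>s - t\<bar> * (K * L1_norm M f)"
proof -
  obtain C where C: "\<And>f. f \<in> L1 M \<Longrightarrow> L1_norm M (G t f) \<le> C * L1_norm M f"
    using G_bound[OF assms] by blast
  have "\<forall>\<^sub>F s in at t. s \<noteq> t"
    by (simp add: eventually_at_filter)
  with G_lim[OF assms zero_less_one] eventually_pos[OF assms]
  have "\<forall>\<^sub>F s in at t. \<forall>f\<in>L1 M.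
      L1_norm M (\<lambda>x. S s f x - S t f x) \<le> \<bar>s - t\<bar> * ((1 + \<bar>C\<bar>) * L1_norm M f)"
  proof (eventually_elim, intro ballI)
    fix s and f :: "'a \<Rightarrow> real"
    assume elim: "\<forall>f\<in>L1 M. L1_norm M (\<lambda>x. (S s f x - S t f x) / (s - t) - G t f x) \<le> 1 * L1_norm M f"
      "0 < s" "s \<noteq> t" "f \<in> L1 M"
    let ?q = "\<lambda>x. (S s f x - S t f x) / (s - t)"
    have mem: "?q \<in> L1 M" "G t f \<in> L1 M"
      using elim assms by (auto intro!: L1_diff L1_divide S_L1 G_L1)
    have "L1_norm M (\<lambda>x. S s f x - S t f x) = L1_norm M (\<lambda>x. (s - t) * ?q x)"
      using elim by simp
    also have "\<dots> = \<bar>s - t\<bar> * L1_norm M ?q"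
      unfolding L1_norm_cmult by simp
    also have "L1_norm M ?q \<le> L1_norm M (\<lambda>x. ?q x - G t f x) + L1_norm M (G t f)"
      using L1_norm_triangle[of "\<lambda>x. ?q x - G t f x" M "G t f"]
      by (simp add: L1_diff mem)
    also have "\<dots> \<le> 1 * L1_norm M f + C * L1_norm M f"
      using elim C by (intro add_mono) auto
    \<comment> \<open>The sign of \<open>C\<close> is unknown; the absolute value ensures that the
      Lipschitz constant is non-negative.\<close>
    also have "\<dots> \<le> (1 + \<bar>C\<bar>) * L1_norm M f"
      by (simp add: distrib_right mult_right_mono L1_norm_nonneg)
    finally show "L1_norm M (\<lambda>x. S s f x - S t f x) \<le> \<bar>s - t\<bar> * ((1 + \<bar>C\<bar>) * L1_norm M f)"
      by (simp add: mult_left_mono)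
  qed
  then show ?thesis
    by (intro that[of "1 + \<bar>C\<bar>"]) auto
qed

lemma S_continuous:
  assumes "0 < t" "f \<in> L1 M"
  shows "L1_tendsto M (\<lambda>s. S s f) (S t f) (at t)"
proof -
  obtain K where K: "\<forall>\<^sub>F s in at t. \<forall>f\<in>L1 M.
      L1_norm M (\<lambda>x. S s f x - S t f x) \<le> \<bar>s - t\<bar> * (K * L1_norm M f)"
    using S_locally_Lipschitz[OF assms(1)] by blast
  have "\<forall>\<^sub>F s in at t. norm (L1_norm M (\<lambda>x. S s f x - S t f x)) \<le> \<bar>s - t\<bar> * (K * L1_norm M f)"
    using K by (rule eventually_mono) (use assms in \<open>auto simp: L1_norm_nonneg\<close>)
  moreover have "((\<lambda>s. \<bar>s - t\<bar> * (K * L1_norm M f)) \<longlongrightarrow> 0) (at t)"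
    by (auto intro!: tendsto_eq_intros)
  ultimately show ?thesis
    unfolding L1_tendsto_def by (rule Lim_null_comparison)
qed

text \<open>At distance less than \<open>1\<close> from \<open>t\<close>, the Lipschitz estimate
  bounds \<open>S s f - S t f\<close> by \<open>L * L1_norm M f\<close>, and the boundedness of the
  single operator \<open>S t\<close> does the rest.\<close>

lemma S_locally_bounded:
  assumes "0 < t"
  obtains K where "\<forall>\<^sub>F s in at t. \<forall>f\<in>L1 M. L1_norm M (S s f) \<le> K * L1_norm M f"
proof -
  obtain L where "0 \<le> L" and L: "\<forall>\<^sub>F s in at t. \<forall>f\<in>L1 M.
      L1_norm M (\<lambda>x. S s f x - S t f x) \<le> \<bar>s - t\<bar> * (L * L1_norm M f)"
    using S_locally_Lipschitz[OF assms] .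
  obtain C where C: "\<And>f. f \<in> L1 M \<Longrightarrow> L1_norm M (S t f) \<le> C * L1_norm M f"
    using bounded_L1_operator_bound[OF S_op[of t]] assms by auto
  have "\<forall>\<^sub>F s in at t. s \<in> {t - 1<..<t + 1}"
    by (rule eventually_at_in_open') auto
  with L eventually_pos[OF assms]
  have "\<forall>\<^sub>F s in at t. \<forall>f\<in>L1 M. L1_norm M (S s f) \<le> (L + C) * L1_norm M f"
  proof (eventually_elim, intro ballI)
    fix s and f :: "'a \<Rightarrow> real"
    assume elim: "\<forall>f\<in>L1 M. L1_norm M (\<lambda>x. S s f x - S t f x) \<le> \<bar>s - t\<bar> * (L * L1_norm M f)"
      "0 < s" "s \<in> {t - 1<..<t + 1}" "f \<in> L1 M"
    have "L1_norm M (S s f) \<le> L1_norm M (\<lambda>x. S s f x - S t f x) + L1_norm M (S t f)"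
      using L1_norm_triangle[of "\<lambda>x. S s f x - S t f x" M "S t f"] elim assms
      by (simp add: L1_diff S_L1)
    also have "\<dots> \<le> \<bar>s - t\<bar> * (L * L1_norm M f) + C * L1_norm M f"
      using elim C by (intro add_mono) auto
    also have "\<dots> \<le> 1 * (L * L1_norm M f) + C * L1_norm M f"
      using elim \<open>0 \<le> L\<close> by (intro add_mono mult_right_mono) (auto simp: L1_norm_nonneg)
    finally show "L1_norm M (S s f) \<le> (L + C) * L1_norm M f"
      by (simp add: distrib_right)
  qed
  then show ?thesis by (rule that)
qed

text \<open>Differentiate \<open>S (s + q) f = S s (S q f)\<close> in \<open>q\<close> at
  \<open>r\<close>. The left side gives \<open>G (s + r) f\<close> by translation; on the right the
  bounded operator \<open>S s\<close> passes through the limit.\<close>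

lemma S_G:
  assumes "0 \<le> s" "0 < r" "f \<in> L1 M"
  shows "L1_eq M (G (s + r) f) (S s (G r f))"
proof (rule L1_tendsto_unique)
  have pos: "0 < s + r" using assms by simp
  let ?q = "\<lambda>q x. (S (s + q) f x - S (s + r) f x) / (q - r)"
  have "filterlim (\<lambda>q. s + q) (at (s + r)) (at r)"
    by (intro filterlim_atI tendsto_intros) (auto simp: eventually_at_filter)
  from L1_tendsto_compose[OF S_derivative[OF pos assms(3)] this]
  show "L1_tendsto M ?q (G (s + r) f) (at r)"
    by simp
  show "\<forall>\<^sub>F q in at r. ?q q \<in> L1 M"
    using eventually_pos[OF assms(2)]
    by (rule eventually_mono) (use assms in \<open>auto intro!: L1_divide L1_diff S_L1\<close>)
  have mem: "\<forall>\<^sub>F q in at r. (\<lambda>x. (S q f x - S r f x) / (q - r)) \<in> L1 M"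
    using eventually_pos[OF assms(2)]
    by (rule eventually_mono) (use assms in \<open>auto intro!: L1_divide L1_diff S_L1\<close>)
  have "L1_tendsto M (\<lambda>q. S s (\<lambda>x. (S q f x - S r f x) / (q - r))) (S s (G r f)) (at r)"
    by (rule bounded_L1_operator_tendsto[OF S_op[OF assms(1)] S_derivative mem])
      (use assms in \<open>auto intro: G_L1\<close>)
  then show "L1_tendsto M ?q (S s (G r f)) (at r)"
  proof (rule L1_tendsto_cong[OF _ _ _ _ L1_eq_refl])
    show "\<forall>\<^sub>F q in at r. S s (\<lambda>x. (S q f x - S r f x) / (q - r)) \<in> L1 M \<and> ?q q \<in> L1 M \<and>
        L1_eq M (S s (\<lambda>x. (S q f x - S r f x) / (q - r))) (?q q)"
      using eventually_pos[OF assms(2)]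
    proof eventually_elim
      case (elim q)
      have "L1_eq M (S s (\<lambda>x. (S q f x - S r f x) / (q - r)))
          (\<lambda>x. (S s (S q f) x - S s (S r f) x) / (q - r))"
        using elim assms by (intro bounded_L1_operator_quotient S_op S_L1) auto
      moreover have "L1_eq M (\<lambda>x. (S s (S q f) x - S s (S r f) x) / (q - r)) (?q q)"
        using elim assms by (intro L1_eq_divide L1_eq_diff L1_eq_sym[OF S_add]) auto
      ultimately have "L1_eq M (S s (\<lambda>x. (S q f x - S r f x) / (q - r))) (?q q)"
        by (rule L1_eq_trans)
      then show ?case
        using elim assms by (auto intro!: S_L1 L1_divide L1_diff)
    qed
  qed (use assms in \<open>auto intro!: S_L1 G_L1\<close>)
qed (use assms in \<open>auto intro!: S_L1 G_L1\<close>)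

lemma S_right_derivative:
  assumes "0 < t" "f \<in> L1 M"
  shows "L1_tendsto M (\<lambda>h x. (S (t + h) f x - S t f x) / h) (G t f) (at_right 0)"
proof -
  have "filterlim (\<lambda>h. t + h) (at t) (at_right 0)"
    by (intro filterlim_atI tendsto_eq_intros) (auto simp: eventually_at_filter)
  from L1_tendsto_compose[OF S_derivative[OF assms] this] show ?thesis by simp
qed

lemma generator_limit_S:
  assumes "0 < t" "f \<in> L1 M"
  shows "generator_limit M S (S t f) (G t f)"
  unfolding generator_limit_def
proof (rule L1_tendsto_cong[OF S_right_derivative[OF assms] _ _ _ L1_eq_refl])
  show "\<forall>\<^sub>F h in at_right 0. (\<lambda>x. (S (t + h) f x - S t f x) / h) \<in> L1 M \<and>
      (\<lambda>x. (S h (S t f) x - S t f x) / h) \<in> L1 M \<and>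
      L1_eq M (\<lambda>x. (S (t + h) f x - S t f x) / h) (\<lambda>x. (S h (S t f) x - S t f x) / h)"
    using eventually_at_right_0
  proof eventually_elim
    case (elim h)
    then show ?case
      using assms S_add[of h t f]
      by (auto intro!: S_L1 L1_divide L1_diff L1_eq_divide L1_eq_diff L1_eq_refl simp: add.commute)
  qed
qed (use assms in \<open>auto intro!: G_L1\<close>)

text \<open>The generator commutes with the semigroup on its domain: here \<open>S t\<close> is
  factored out on the left of \<open>S (t + h) f - S t f\<close>, whereas
  \<open>generator_limit_S\<close> keeps it as the argument of \<open>S h\<close>. This is what
  makes the two terms of the product rule cancel in the uniqueness proof.\<close>

lemma generator_limit_G:
  assumes "0 < t" "f \<in> L1 M" "g \<in> L1 M" "generator_limit M S f g"
  shows "L1_eq M (G t f) (S t g)"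
proof (rule L1_tendsto_unique[OF S_right_derivative[OF assms(1,2)]])
  show "\<forall>\<^sub>F h in at_right 0. (\<lambda>x. (S (t + h) f x - S t f x) / h) \<in> L1 M"
    using eventually_at_right_0
    by (rule eventually_mono) (use assms in \<open>auto intro!: S_L1 L1_divide L1_diff\<close>)
  have mem: "\<forall>\<^sub>F h in at_right 0. (\<lambda>x. (S h f x - f x) / h) \<in> L1 M"
    using eventually_at_right_0
    by (rule eventually_mono) (use assms in \<open>auto intro!: S_L1 L1_divide L1_diff\<close>)
  have "L1_tendsto M (\<lambda>h. S t (\<lambda>x. (S h f x - f x) / h)) (S t g) (at_right 0)"
    by (rule bounded_L1_operator_tendsto[OF S_op _ mem])
      (use assms in \<open>auto simp: generator_limit_def\<close>)
  then show "L1_tendsto M (\<lambda>h x. (S (t + h) f x - S t f x) / h) (S t g) (at_right 0)"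
  proof (rule L1_tendsto_cong[OF _ _ _ _ L1_eq_refl])
    show "\<forall>\<^sub>F h in at_right 0. S t (\<lambda>x. (S h f x - f x) / h) \<in> L1 M \<and>
        (\<lambda>x. (S (t + h) f x - S t f x) / h) \<in> L1 M \<and>
        L1_eq M (S t (\<lambda>x. (S h f x - f x) / h)) (\<lambda>x. (S (t + h) f x - S t f x) / h)"
      using eventually_at_right_0
    proof eventually_elim
      case (elim h)
      have "L1_eq M (S t (\<lambda>x. (S h f x - f x) / h)) (\<lambda>x. (S t (S h f) x - S t f x) / h)"
        using elim assms by (intro bounded_L1_operator_quotient S_op S_L1) auto
      moreover have "L1_eq M (\<lambda>x. (S t (S h f) x - S t f x) / h)
          (\<lambda>x. (S (t + h) f x - S t f x) / h)"
        using elim assms by (intro L1_eq_divide L1_eq_diff L1_eq_refl L1_eq_sym[OF S_add]) auto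
      ultimately have "L1_eq M (S t (\<lambda>x. (S h f x - f x) / h))
          (\<lambda>x. (S (t + h) f x - S t f x) / h)"
        by (rule L1_eq_trans)
      then show ?case
        using elim assms by (auto intro!: S_L1 L1_divide L1_diff)
    qed
  qed (use assms in \<open>auto intro!: S_L1\<close>)
qed (use assms in \<open>auto intro!: S_L1 G_L1\<close>)

lemma generator_limit_unique:
  assumes "f \<in> L1 M" "g \<in> L1 M" "h \<in> L1 M" "generator_limit M S f g" "generator_limit M S f h"
  shows "L1_eq M g h"
proof (rule L1_tendsto_unique)
  show "\<forall>\<^sub>F s in at_right 0. (\<lambda>x. (S s f x - f x) / s) \<in> L1 M"
    using eventually_at_right_0
    by (rule eventually_mono) (use assms in \<open>auto intro!: S_L1 L1_divide L1_diff\<close>)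
qed (use assms in \<open>auto simp: generator_limit_def\<close>)

lemma G_continuous:
  assumes "0 < t" "f \<in> L1 M"
  shows "L1_tendsto M (\<lambda>s. G s f) (G t f) (at t)"
proof -
  \<comment> \<open>Any \<open>r\<close> strictly between \<open>0\<close> and \<open>t\<close>
    would do: \<open>G r f\<close> must exist, and \<open>S\<close> must be known to be continuous
    at \<open>t - r > 0\<close>.\<close>
  define r where "r = t / 2"
  have r: "0 < r" "0 < t - r" using assms by (simp_all add: r_def)
  have G_eq: "L1_eq M (S (s - r) (G r f)) (G s f)" if "r < s" for s
    using L1_eq_sym[OF S_G[of "s - r" r f]] that r assms by simp
  have "filterlim (\<lambda>s. s - r) (at (t - r)) (at t)"
    by (intro filterlim_atI tendsto_intros) (auto simp: eventually_at_filter)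
  from L1_tendsto_compose[OF S_continuous[OF r(2) G_L1[OF r(1) assms(2)]] this]
  show ?thesis
  proof (rule L1_tendsto_cong)
    have "\<forall>\<^sub>F s in at t. s \<in> {r<..}"
      using r by (intro eventually_at_in_open') auto
    then show "\<forall>\<^sub>F s in at t. S (s - r) (G r f) \<in> L1 M \<and> G s f \<in> L1 M \<and>
        L1_eq M (S (s - r) (G r f)) (G s f)"
      by (rule eventually_mono) (use r assms G_eq in \<open>auto intro!: S_L1 G_L1\<close>)
  qed (use r assms G_eq in \<open>auto intro!: S_L1 G_L1\<close>)
qed

section \<open>Existence: orbits are classical solutions\<close>

theorem classical_solution_semigroup:
  assumes "is_generator M S D L" "f \<in> L1 M"
  shows "classical_solution M D L f (\<lambda>t. S t f)"
  unfolding classical_solution_def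
proof (intro conjI exI[of _ "\<lambda>t. G t f"] allI impI)
  fix t :: real
  show "S t f \<in> L1 M" if "0 \<le> t" using S_L1[OF that assms(2)] .
  show "L1_tendsto M (\<lambda>t. S t f) (S t f) (at t within {0..})" if "0 \<le> t"
  proof (cases "t = 0")
    case True
    \<comment> \<open>Strong continuity gives the limit \<open>f\<close>, while continuity of the
      orbit asks for \<open>S 0 f\<close>; the two agree only almost everywhere, so the limit is
      exchanged.\<close>
    have "\<forall>\<^sub>F s in at_right 0. S s f \<in> L1 M \<and> S s f \<in> L1 M \<and> L1_eq M (S s f) (S s f)"
      using eventually_at_right_0
      by (rule eventually_mono) (use assms in \<open>auto intro!: S_L1 L1_eq_refl\<close>)
    from L1_tendsto_cong[OF S_tendsto_0[OF assms(2)] this assms(2) S_L1[of 0, OF _ assms(2)]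
        L1_eq_sym[OF S_zero[OF assms(2)]]]
    show ?thesis
      using True by (simp add: at_within_Ici_at_right)
  next
    case False
    then have "0 < t" using that by simp
    then show ?thesis
      using S_continuous[OF _ assms(2)] tendsto_within_subset[of _ _ _ UNIV]
      unfolding L1_tendsto_def by blast
  qed
  show "L1_eq M (S 0 f) f" using S_zero[OF assms(2)] .
  assume t: "0 < t"
  show "G t f \<in> L1 M" using G_L1[OF t assms(2)] .
  show "L1_tendsto M (\<lambda>s x. (S s f x - S t f x) / (s - t)) (G t f) (at t)"
    using S_derivative[OF t assms(2)] .
  show "L1_tendsto M (\<lambda>t. G t f) (G t f) (at t)"
    using G_continuous[OF t assms(2)] .
  have "S t f \<in> L1 M" using S_L1 t assms(2) by simp
  then show dom: "S t f \<in> D"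
    using assms(1) generator_limit_S[OF t assms(2)] G_L1[OF t assms(2)]
    unfolding is_generator_def by blast
  \<comment> \<open>\<open>L (S t f)\<close> is known only as a generator limit at
    \<open>S t f\<close>, and \<open>G t f\<close> is another one; uniqueness of the limit
    identifies them.\<close>
  then show "L1_eq M (G t f) (L (S t f))"
    using assms(1) generator_limit_unique[OF \<open>S t f \<in> L1 M\<close> G_L1[OF t assms(2)] _
        generator_limit_S[OF t assms(2)]]
    unfolding is_generator_def by blast
qed

section \<open>Uniqueness: the product rule for \<open>S (\<tau> - s) (v s)\<close>\<close>

text \<open>The increment splits into \<open>S (\<tau> - p)\<close> applied to
  \<open>v p - v s\<close>, controlled by the local bound on \<open>S\<close>, and the increment of
  \<open>S\<close> at the fixed vector \<open>v s\<close>. Both facts about \<open>S\<close> are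
  used at \<open>\<tau> - s\<close>, hence the strict inequality \<open>s < \<tau>\<close>.\<close>

lemma S_product_continuous:
  assumes "s < \<tau>" "L1_tendsto M v (v s) (at s within A)"
    and v: "\<And>p. p \<in> A \<Longrightarrow> v p \<in> L1 M" and "v s \<in> L1 M"
  shows "L1_tendsto M (\<lambda>p. S (\<tau> - p) (v p)) (S (\<tau> - s) (v s)) (at s within A)"
proof -
  have pos: "0 < \<tau> - s" using assms(1) by simp
  have "filterlim (\<lambda>p. \<tau> - p) (at (\<tau> - s)) (at s within A)"
    by (intro filterlim_atI tendsto_intros) (auto simp: eventually_at_filter)
  note sub = this eventually_compose_filterlim[OF _ this]
  obtain K where K: "\<forall>\<^sub>F p in at (\<tau> - s). \<forall>f\<in>L1 M. L1_norm M (S p f) \<le> K * L1_norm M f"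
    using S_locally_bounded[OF pos] .
  let ?N = "\<lambda>p. K * L1_norm M (\<lambda>x. v p x - v s x)
      + L1_norm M (\<lambda>x. S (\<tau> - p) (v s) x - S (\<tau> - s) (v s) x)"
  have "\<forall>\<^sub>F p in at s within A. p \<in> A"
    by (simp add: eventually_at_filter)
  with sub(2)[OF K] sub(2)[OF eventually_pos[OF pos]]
  have "\<forall>\<^sub>F p in at s within A.
      norm (L1_norm M (\<lambda>x. S (\<tau> - p) (v p) x - S (\<tau> - s) (v s) x)) \<le> ?N p"
  proof eventually_elim
    case (elim p)
    then have p: "0 \<le> \<tau> - p" "v p \<in> L1 M" using v by auto
    let ?f = "S (\<tau> - p) (\<lambda>x. v p x - v s x)"
    let ?g = "\<lambda>x. S (\<tau> - p) (v s) x - S (\<tau> - s) (v s) x"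
    have mem: "?f \<in> L1 M" "?g \<in> L1 M"
      using p pos assms by (auto intro!: S_L1 L1_diff)
    have "L1_norm M (\<lambda>x. S (\<tau> - p) (v p) x - S (\<tau> - s) (v s) x) = L1_norm M (\<lambda>x. ?f x + ?g x)"
    proof (rule L1_norm_cong)
      show "L1_eq M (\<lambda>x. S (\<tau> - p) (v p) x - S (\<tau> - s) (v s) x) (\<lambda>x. ?f x + ?g x)"
        using bounded_L1_operator_diff[OF S_op[OF p(1)] p(2) assms(4)]
        unfolding L1_eq_def by eventually_elim simp
    qed (use p pos assms mem in \<open>auto intro!: S_L1 L1_diff L1_add\<close>)
    also have "\<dots> \<le> L1_norm M ?f + L1_norm M ?g"
      by (rule L1_norm_triangle[OF mem])
    also have "\<dots> \<le> ?N p"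
      using elim(1) p assms by (intro add_mono) (auto intro: L1_diff)
    finally show ?case
      by (simp add: L1_norm_nonneg)
  qed
  moreover have "(?N \<longlongrightarrow> 0) (at s within A)"
    using assms(2) L1_tendsto_compose[OF S_continuous[OF pos assms(4)] sub(1)]
    unfolding L1_tendsto_def by (intro tendsto_add_zero tendsto_mult_right_zero)
  ultimately show ?thesis
    unfolding L1_tendsto_def by (rule Lim_null_comparison)
qed

text \<open>By the product rule the derivative is
  \<open>S (\<tau> - s) v' - G (\<tau> - s) (v s)\<close>, the minus sign coming from the reversed
  time; \<open>eq\<close> says that this vanishes.\<close>

lemma S_product_derivative:
  assumes "s < \<tau>" and v: "\<forall>\<^sub>F p in at s. v p \<in> L1 M" "v s \<in> L1 M" and v': "v' \<in> L1 M"
    and dv: "L1_tendsto M (\<lambda>p x. (v p x - v s x) / (p - s)) v' (at s)"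
    and eq: "L1_eq M (G (\<tau> - s) (v s)) (S (\<tau> - s) v')"
  shows "L1_tendsto M (\<lambda>p x. (S (\<tau> - p) (v p) x - S (\<tau> - s) (v s) x) / (p - s)) (\<lambda>x. 0) (at s)"
proof -
  have pos: "0 < \<tau> - s" using assms(1) by simp
  have "filterlim (\<lambda>p. \<tau> - p) (at (\<tau> - s)) (at s)"
    by (intro filterlim_atI tendsto_intros) (auto simp: eventually_at_filter)
  note sub = this eventually_compose_filterlim[OF _ this]
  obtain K where K: "\<forall>\<^sub>F p in at (\<tau> - s). \<forall>f\<in>L1 M. L1_norm M (S p f) \<le> K * L1_norm M f"
    using S_locally_bounded[OF pos] .
  \<comment> \<open>Three errors: \<open>q\<close> for the difference quotient of \<open>v\<close>,
    \<open>g\<close> for moving \<open>S (\<tau> - p)\<close> to \<open>S (\<tau> - s)\<close> at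
    the fixed vector \<open>v'\<close>, and \<open>h\<close> for the difference quotient of
    \<open>S\<close> at the fixed vector \<open>v s\<close>. In
    \<open>S (\<tau> - p) (q p) + g p - h p\<close> the leading terms cancel by \<open>eq\<close>,
    leaving exactly the quotient to be estimated.\<close>
  define q where "q p = (\<lambda>x. (v p x - v s x) / (p - s) - v' x)" for p
  define g where "g p = (\<lambda>x. S (\<tau> - p) v' x - S (\<tau> - s) v' x)" for p
  define h where "h p = (\<lambda>x. (S (\<tau> - p) (v s) x - S (\<tau> - s) (v s) x) / ((\<tau> - p) - (\<tau> - s))
      - G (\<tau> - s) (v s) x)" for p
  let ?w = "\<lambda>p x. (S (\<tau> - p) (v p) x - S (\<tau> - s) (v s) x) / (p - s)"
  have "\<forall>\<^sub>F p in at s. p \<noteq> s"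
    by (simp add: eventually_at_filter)
  with v(1) sub(2)[OF K] sub(2)[OF eventually_pos[OF pos]]
  have "\<forall>\<^sub>F p in at s. norm (L1_norm M (\<lambda>x. ?w p x - 0))
      \<le> K * L1_norm M (q p) + L1_norm M (g p) + L1_norm M (h p)"
  proof eventually_elim
    case (elim p)
    then have p: "0 \<le> \<tau> - p" by simp
    note op = S_op[OF p]
    have quot: "(\<lambda>x. (v p x - v s x) / (p - s)) \<in> L1 M"
      using elim v by (auto intro!: L1_divide L1_diff)
    have mem: "q p \<in> L1 M" "S (\<tau> - p) (q p) \<in> L1 M" "g p \<in> L1 M" "h p \<in> L1 M"
      using p pos elim v v' quot unfolding q_def g_def h_def
      by (auto intro!: S_L1 G_L1 L1_diff L1_divide)
    have "L1_norm M (?w p) = L1_norm M (\<lambda>x. S (\<tau> - p) (q p) x + g p x - h p x)"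
    proof (rule L1_norm_cong)
      have "L1_eq M (S (\<tau> - p) (q p))
          (\<lambda>x. S (\<tau> - p) (\<lambda>x. (v p x - v s x) / (p - s)) x - S (\<tau> - p) v' x)"
        unfolding q_def by (rule bounded_L1_operator_diff[OF op quot v'])
      with bounded_L1_operator_quotient[OF op elim(1) v(2), of "p - s"] eq
      show "L1_eq M (?w p) (\<lambda>x. S (\<tau> - p) (q p) x + g p x - h p x)"
        unfolding L1_eq_def
      proof eventually_elim
        case (elim x)
        have "(\<tau> - p) - (\<tau> - s) = - (p - s)" by simp
        then have "y / ((\<tau> - p) - (\<tau> - s)) = - (y / (p - s))" for y
          by (simp only: minus_divide_right)
        then show ?case
          unfolding g_def h_def using elim by (simp only: diff_divide_distrib)
      qed
      show "?w p \<in> L1 M"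
        by (rule L1_divide[OF L1_diff[OF S_L1[OF p elim(1)] S_L1[OF less_imp_le[OF pos] v(2)]]])
      show "(\<lambda>x. S (\<tau> - p) (q p) x + g p x - h p x) \<in> L1 M"
        by (rule L1_diff[OF L1_add[OF mem(2,3)] mem(4)])
    qed
    also have "\<dots> \<le> L1_norm M (\<lambda>x. S (\<tau> - p) (q p) x + g p x) + L1_norm M (h p)"
      using L1_norm_triangle[of "\<lambda>x. S (\<tau> - p) (q p) x + g p x" M "\<lambda>x. - 1 * h p x"]
        mem L1_norm_cmult[of M "- 1" "h p"]
      by (simp add: L1_def)
    also have "\<dots> \<le> L1_norm M (S (\<tau> - p) (q p)) + L1_norm M (g p) + L1_norm M (h p)"
      using L1_norm_triangle[OF mem(2,3)] by simp
    also have "\<dots> \<le> K * L1_norm M (q p) + L1_norm M (g p) + L1_norm M (h p)"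
      using elim mem by simp
    finally show ?case
      by (simp add: L1_norm_nonneg)
  qed
  moreover have "((\<lambda>p. K * L1_norm M (q p) + L1_norm M (g p) + L1_norm M (h p)) \<longlongrightarrow> 0) (at s)"
    using dv L1_tendsto_compose[OF S_continuous[OF pos v'] sub(1)]
      L1_tendsto_compose[OF S_derivative[OF pos v(2)] sub(1)]
    unfolding L1_tendsto_def q_def g_def h_def
    by (intro tendsto_add_zero tendsto_mult_right_zero)
  ultimately show ?thesis
    unfolding L1_tendsto_def by (rule Lim_null_comparison)
qed

text \<open>The curve \<open>s \<mapsto> S (t + \<epsilon> - s) (v s)\<close> is constant on \<open>[0, t]\<close>. The shift by \<open>\<epsilon> > 0\<close> keeps the
  semigroup away from time \<open>0\<close>, where a local bound on its norm would need the uniform boundedness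
  principle.\<close>

theorem classical_solution_unique:
  assumes gen: "is_generator M S D L" and f: "f \<in> L1 M"
    and sol: "classical_solution M D L f v" and t: "0 \<le> t"
  shows "L1_eq M (v t) (S t f)"
proof -
  have v: "\<And>t. 0 \<le> t \<Longrightarrow> v t \<in> L1 M"
    and v_cont: "\<And>t. 0 \<le> t \<Longrightarrow> L1_tendsto M v (v t) (at t within {0..})"
    and v_0: "L1_eq M (v 0) f"
    using sol unfolding classical_solution_def by auto
  obtain v' where v': "\<And>t. 0 < t \<Longrightarrow> v' t \<in> L1 M"
    and dv: "\<And>t. 0 < t \<Longrightarrow> L1_tendsto M (\<lambda>s x. (v s x - v t x) / (s - t)) (v' t) (at t)"
    and dom: "\<And>t. 0 < t \<Longrightarrow> v t \<in> D"
    and ode: "\<And>t. 0 < t \<Longrightarrow> L1_eq M (v' t) (L (v t))"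
    using sol unfolding classical_solution_def by blast
  have L: "L (v s) \<in> L1 M" "generator_limit M S (v s) (L (v s))" if "0 < s" for s
    using gen dom[OF that] unfolding is_generator_def by auto
  have const: "L1_eq M (S (t + \<epsilon>) (v 0)) (S \<epsilon> (v t))" if "0 < \<epsilon>" "0 < t" for \<epsilon>
  proof -
    have "L1_eq M (S (t + \<epsilon> - 0) (v 0)) (S (t + \<epsilon> - t) (v t))"
    proof (rule L1_zero_derivative_imp_const[OF \<open>0 < t\<close>, where w = "\<lambda>s. S (t + \<epsilon> - s) (v s)"])
      fix s assume "s \<in> {0..t}"
      then have s: "0 \<le> s" "s < t + \<epsilon>" "v s \<in> L1 M" using v that by auto
      then show "S (t + \<epsilon> - s) (v s) \<in> L1 M" by (intro S_L1) auto
      have "L1_tendsto M v (v s) (at s within {0..t})"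
        using v_cont[OF s(1)] tendsto_within_subset[of _ _ s "{0..}" "{0..t}"]
        unfolding L1_tendsto_def by auto
      then show "L1_tendsto M (\<lambda>s. S (t + \<epsilon> - s) (v s)) (S (t + \<epsilon> - s) (v s)) (at s within {0..t})"
        using s v by (intro S_product_continuous) auto
    next
      fix s assume "s \<in> {0<..<t}"
      then have s: "0 < s" "s < t + \<epsilon>" using that by auto
      \<comment> \<open>Since \<open>v s\<close> lies in the domain, the semigroup commutes with the
        generator there; the differential equation then replaces \<open>L (v s)\<close> by
        \<open>v' s\<close>, which is the cancellation condition of the product rule.\<close>
      have "L1_eq M (G (t + \<epsilon> - s) (v s)) (S (t + \<epsilon> - s) (L (v s)))"
        using s v L by (intro generator_limit_G) auto
      moreover have "L1_eq M (S (t + \<epsilon> - s) (L (v s))) (S (t + \<epsilon> - s) (v' s))"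
        by (rule bounded_L1_operator_cong[OF S_op L(1)[OF s(1)] v'[OF s(1)]
              L1_eq_sym[OF ode[OF s(1)]]]) (use s in simp)
      ultimately have eq: "L1_eq M (G (t + \<epsilon> - s) (v s)) (S (t + \<epsilon> - s) (v' s))"
        by (rule L1_eq_trans)
      have "\<forall>\<^sub>F p in at s. v p \<in> L1 M"
        using eventually_pos[OF s(1)] by (rule eventually_mono) (simp add: v)
      then show "L1_tendsto M (\<lambda>p x. (S (t + \<epsilon> - p) (v p) x - S (t + \<epsilon> - s) (v s) x) / (p - s))
          (\<lambda>x. 0) (at s)"
        using s by (intro S_product_derivative[OF _ _ _ _ dv eq] v v') auto
    qed
    then show ?thesis by simp
  qed
  have "L1_eq M (v t) (S t (v 0))"
  proof (cases "t = 0")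
    case True
    then show ?thesis using L1_eq_sym[OF S_zero[OF v]] by simp
  next
    case False
    with t have t: "0 < t" by simp
    \<comment> \<open>The shift, now called \<open>h\<close>, tends to \<open>0\<close>: one side of
      \<open>const\<close> converges by continuity of the orbit at \<open>t > 0\<close>, the other
      by strong continuity at time \<open>0\<close> on the fixed vector \<open>v t\<close>. Hence
      the separate treatment of \<open>t = 0\<close>.\<close>
    have "filterlim (\<lambda>h. t + h) (at t) (at_right 0)"
      by (intro filterlim_atI tendsto_eq_intros) (auto simp: eventually_at_filter)
    from L1_tendsto_compose[OF S_continuous[OF t v[OF order_refl]] this]
    have "L1_tendsto M (\<lambda>h. S (t + h) (v 0)) (S t (v 0)) (at_right 0)" .
    moreover have "\<forall>\<^sub>F h in at_right 0. S (t + h) (v 0) \<in> L1 M \<and> S h (v t) \<in> L1 M \<and>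
        L1_eq M (S (t + h) (v 0)) (S h (v t))"
      using eventually_at_right_0
      by (rule eventually_mono) (use t v const in \<open>auto intro!: S_L1\<close>)
    moreover have St: "S t (v 0) \<in> L1 M" using t v by (intro S_L1) auto
    ultimately have "L1_tendsto M (\<lambda>h. S h (v t)) (S t (v 0)) (at_right 0)"
      by (rule L1_tendsto_cong[OF _ _ _ _ L1_eq_refl]) (rule St)
    moreover have vt: "v t \<in> L1 M" using t v by auto
    moreover have "\<forall>\<^sub>F h in at_right 0. S h (v t) \<in> L1 M"
      using eventually_at_right_0 by (rule eventually_mono) (use t v in \<open>auto intro!: S_L1\<close>)
    ultimately show ?thesis
      by (intro L1_tendsto_unique[OF S_tendsto_0[OF vt] _ trivial_limit_at_right_real _ _ St])
  qed
  moreover have "L1_eq M (S t (v 0)) (S t f)"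
    by (rule bounded_L1_operator_cong[OF S_op[OF t] v f v_0]) simp
  ultimately show ?thesis by (rule L1_eq_trans)
qed

end

section \<open>The equation governed by \<open>AB_op a b\<close> on the weighted space\<close>

theorem corollary4p3:
  fixes a \<omega> :: "real \<Rightarrow> real" and b :: "real \<Rightarrow> real \<Rightarrow> real"
    and \<kappa>\<^sub>1 \<kappa>\<^sub>2 \<eta>\<^sub>0 :: real
    and S :: "real \<Rightarrow> (real \<Rightarrow> real) \<Rightarrow> (real \<Rightarrow> real)"
  assumes a_loc: "a \<in> Linf_loc"
    and a_nonneg: "AE x in lebesgue_on {0<..}. 0 \<le> a x"
    and b_nonneg: "\<And>x y. 0 < x \<Longrightarrow> 0 < y \<Longrightarrow> 0 \<le> b x y"
    and b_meas: "(\<lambda>(x, y). b x y) \<in> borel_measurable (lebesgue_on ({0<..} \<times> {0<..}))"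
    and b_zero: "AE (x, y) in lebesgue_on ({0<..} \<times> {0<..}). y < x \<longrightarrow> b x y = 0"
    and \<omega>_nonneg: "\<And>x. 0 \<le> x \<Longrightarrow> 0 \<le> \<omega> x"
    and \<omega>_meas: "\<omega> \<in> borel_measurable (lebesgue_on {0..})"
    and \<kappa>\<^sub>1: "0 < \<kappa>\<^sub>1" and \<kappa>\<^sub>2: "0 < \<kappa>\<^sub>2" "\<kappa>\<^sub>2 < 1" and \<eta>\<^sub>0: "0 < \<eta>\<^sub>0"
    and small: "\<And>y. 0 < y \<Longrightarrow> y \<le> \<eta>\<^sub>0 \<Longrightarrow>
      (\<integral>\<^sup>+x. ennreal (b x y * \<omega> x) \<partial>lebesgue_on {0<..<y}) \<le> ennreal (\<kappa>\<^sub>1 * \<omega> y)"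
    and large: "\<And>y. \<eta>\<^sub>0 \<le> y \<Longrightarrow>
      (\<integral>\<^sup>+x. ennreal (b x y * \<omega> x) \<partial>lebesgue_on {0<..<y}) \<le> ennreal (\<kappa>\<^sub>2 * \<omega> y)"
    and semigroup: "C0_semigroup (weighted \<omega>) S"
    and analytic: "analytic_semigroup (weighted \<omega>) S"
    and positive: "positive_semigroup (weighted \<omega>) S"
    and generator: "is_generator (weighted \<omega>) S (A_dom \<omega> a) (AB_op a b)"
  shows "\<forall>u0 \<in> L1 (weighted \<omega>).
    classical_solution (weighted \<omega>) (A_dom \<omega> a) (AB_op a b) u0 (\<lambda>t. S t u0) \<and>
    (\<forall>v. classical_solution (weighted \<omega>) (A_dom \<omega> a) (AB_op a b) u0 v \<longrightarrow>
      (\<forall>t\<ge>0. L1_eq (weighted \<omega>) (v t) (S t u0))) \<and>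
    (L1_nonneg (weighted \<omega>) u0 \<longrightarrow> (\<forall>t\<ge>0. L1_nonneg (weighted \<omega>) (S t u0)))"
proof -
  obtain G where "differentiable_C0_semigroup (weighted \<omega>) S G"
    using analytic_semigroup_differentiable[OF semigroup analytic] .
  then interpret differentiable_C0_semigroup "weighted \<omega>" S G .
  show ?thesis
    \<comment> \<open>The solution is the orbit \<open>S t u0\<close> itself, so its sign is read
      off from positivity of the semigroup.\<close>
    using classical_solution_semigroup[OF generator] classical_solution_unique[OF generator]
      positive
    unfolding positive_semigroup_def by blast
qed

end
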